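(* Let $G=(V,E,w)$ be a connected graph and let $\pi\in\mathscr{P}_\star(V)$ be the stationary distribution of the simple random walk on $V$. For $\mu\in\mathscr{P}_\star(V)$ put $w^{(\mu)}_{xy}:=w_{xy}\,\theta\left(\frac{\mu(x)}{\pi(x)},\frac{\mu(y)}{\pi(y)}\right)$ for $\{x,y\}\in E$. Then $w^{(\pi)}=w$, hence $L_{w^{(\pi)}}=L_w$, and for every fixed $h\in\mathbb{R}^V_0$ with $\|h\|_2\le1$, $$\mathcal{M}(\pi,\pi+\varepsilon h)^2=|\varepsilon|^2\,h^\top L_w^\dagger h+o(|\varepsilon|^2)\quad\text{as }\varepsilon\to0,$$ with constants depending only on $G$; that is, there are constants $C,C'>0$ depending only on $G$ such that for all $\varepsilon\in\mathbb{R}$ with $|\varepsilon|$ sufficiently small (depending only on $G$), $$\frac{\varepsilon^2}{1+C'|\varepsilon|}\,h^\top L_w^\dagger h\le\mathcal{M}(\pi,\pi+\varepsilon h)^2\le\frac{\varepsilon^2}{1-C|\varepsilon|}\,h^\top L_w^\dagger h.$$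
   Context: A graph $G=(V,E,w)$ consists of a finite vertex set $V$, a set $E$ of $m\ge 1$ undirected edges (unordered pairs of distinct vertices), and positive edge weights $w=(w_{xy})_{\{x,y\}\in E}$ (with $w_{xy}=w_{yx}$). Write $y\sim x$ if $\{x,y\}\in E$. The degree of $x$ is $\mathrm{d}_x=\sum_{y\sim x}w_{xy}$; $D_w$ is the diagonal degree matrix, $A_w$ the weighted adjacency matrix, and $L_w=D_w-A_w$ the Laplacian matrix; the same notation is used for any other positive edge weights on $E$. The simple random walk on $V$ is the Markov chain with transition matrix $P=D_w^{-1}A_w$; for connected $G$ its unique stationary distribution is $\pi(x)=\mathrm{d}_x/\sum_{z\in V}\mathrm{d}_z$. $\mathscr{P}(V)$ is the simplex of probability densities on $V$ (nonnegative vectors in $\mathbb{R}^V$ with entries summing to $1$), and $\mathscr{P}_\star(V)$ is its interior (everywhere positive densities). $\mathbb{R}^V_0=\{f\in\mathbb{R}^V:\sum_{x}f(x)=0\}$. $X^\dagger$ is the Moore--Penrose inverse of a matrix $X$. The logarithmic mean is $\theta(a,b)=\int_0^1 a^{1-\lambda}b^\lambda\,d\lambda$ for $a,b\ge0$. Discrete transportation distance: for $\mu,\nu\in\mathscr{P}_\star(V)$, $$\mathcal{M}(\mu,\nu)^2=\inf \int_0^1\sum_{\{x,y\}\in E}w_{xy}(\psi_t(x)-\psi_t(y))^2\,\theta\left(\frac{\rho_t(x)}{\pi(x)},\frac{\rho_t(y)}{\pi(y)}\right)dt,$$ where the infimum is over all $\mathcal{C}^1$ curves $(\rho_t)_{t\in[0,1]}$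 with values in $\mathscr{P}_\star(V)$ and all Borel measurable $(\psi_t)_{t\in[0,1]}$ with values in $\mathbb{R}^V$ such that $\rho_0=\mu$, $\rho_1=\nu$, and for all $x\in V$, $t\in[0,1]$, $$\frac{d}{dt}\rho_t(x)+\sum_{y\sim x}w_{xy}(\psi_t(y)-\psi_t(x))\,\theta\left(\frac{\rho_t(x)}{\pi(x)},\frac{\rho_t(y)}{\pi(y)}\right)=0.$$ *)

theory Defs
  imports "HOL-Analysis.Analysis" "HOL-Library.Landau_Symbols"
begin

text \<open>
  The vertex set is the universe of a finite type. Edges are two-element sets of vertices;
  weights are functions of two vertices of which only the values on edges matter.
\<close>

definition weighted_graph :: "'v set set \<Rightarrow> ('v \<Rightarrow> 'v \<Rightarrow> real) \<Rightarrow> bool" where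
  "weighted_graph E w \<longleftrightarrow>
     E \<noteq> {} \<and> (\<forall>e\<in>E. card e = 2) \<and>
     (\<forall>x y. {x, y} \<in> E \<longrightarrow> w x y = w y x \<and> w x y > 0)"

definition connected_graph :: "'v set set \<Rightarrow> bool" where
  "connected_graph E \<longleftrightarrow> (\<forall>x y. (x, y) \<in> {(a, b). {a, b} \<in> E}\<^sup>*)"

definition wdeg :: "'v::finite set set \<Rightarrow> ('v \<Rightarrow> 'v \<Rightarrow> real) \<Rightarrow> 'v \<Rightarrow> real" where
  "wdeg E w x = (\<Sum>y | {x, y} \<in> E. w x y)"

definition degree_matrix :: "'v::finite set set \<Rightarrow> ('v \<Rightarrow> 'v \<Rightarrow> real) \<Rightarrow> real^'v^'v" where
  "degree_matrix E w = (\<chi> x y. if x = y then wdeg E w x else 0)"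

definition adjacency_matrix :: "'v::finite set set \<Rightarrow> ('v \<Rightarrow> 'v \<Rightarrow> real) \<Rightarrow> real^'v^'v" where
  "adjacency_matrix E w = (\<chi> x y. if {x, y} \<in> E then w x y else 0)"

definition laplacian :: "'v::finite set set \<Rightarrow> ('v \<Rightarrow> 'v \<Rightarrow> real) \<Rightarrow> real^'v^'v" where
  "laplacian E w = degree_matrix E w - adjacency_matrix E w"

definition srw_matrix :: "'v::finite set set \<Rightarrow> ('v \<Rightarrow> 'v \<Rightarrow> real) \<Rightarrow> real^'v^'v" where
  "srw_matrix E w = matrix_inv (degree_matrix E w) ** adjacency_matrix E w"

definition densities :: "(real^'v::finite) set" where
  "densities = {\<rho>. (\<forall>x. \<rho> $ x \<ge> 0) \<and> (\<Sum>x\<in>UNIV. \<rho> $ x) = 1}"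

definition positive_densities :: "(real^'v::finite) set" where
  "positive_densities = {\<rho> \<in> densities. \<forall>x. \<rho> $ x > 0}"

definition stationary :: "real^'v^'v \<Rightarrow> real^'v::finite \<Rightarrow> bool" where
  "stationary P \<pi> \<longleftrightarrow> \<pi> \<in> densities \<and> \<pi> v* P = \<pi>"

definition zero_sum :: "(real^'v::finite) set" where
  "zero_sum = {f. (\<Sum>x\<in>UNIV. f $ x) = 0}"

text \<open>The Moore--Penrose inverse of a real matrix, by the four Penrose equations.\<close>

definition is_pseudo_inverse :: "real^'n^'m \<Rightarrow> real^'m^'n \<Rightarrow> bool" where
  "is_pseudo_inverse A X \<longleftrightarrow>
     A ** X ** A = A \<and> X ** A ** X = X \<and>
     transpose (A ** X) = A ** X \<and> transpose (X ** A) = X ** A"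

definition pseudo_inverse :: "real^'n^'m \<Rightarrow> real^'m^'n" where
  "pseudo_inverse A = (THE X. is_pseudo_inverse A X)"

text \<open>For \<open>a = 0\<close> or \<open>b = 0\<close> the convention \<open>0 powr 0 = 0\<close> only affects the endpoints.\<close>

definition log_mean :: "real \<Rightarrow> real \<Rightarrow> real" where
  "log_mean a b = integral {0..1} (\<lambda>s. a powr (1 - s) * b powr s)"

definition reweight ::
  "('v \<Rightarrow> 'v \<Rightarrow> real) \<Rightarrow> real^'v::finite \<Rightarrow> real^'v \<Rightarrow> 'v \<Rightarrow> 'v \<Rightarrow> real" where
  "reweight w \<pi> \<mu> x y = w x y * log_mean (\<mu> $ x / \<pi> $ x) (\<mu> $ y / \<pi> $ y)"

text \<open>
  The sum of a symmetric \<open>f x y\<close> over the unordered edges \<open>{x, y}\<close>: each edge occurs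
  twice among the ordered pairs.
\<close>

definition edge_sum :: "'v::finite set set \<Rightarrow> ('v \<Rightarrow> 'v \<Rightarrow> real) \<Rightarrow> real" where
  "edge_sum E f = (\<Sum>(x, y)\<in>{(x, y). {x, y} \<in> E}. f x y) / 2"

lemma edge_sum_eq:
  fixes E :: "'v::finite set set"
  assumes "\<forall>e\<in>E. card e = 2" and "\<And>x y. {x, y} \<in> E \<Longrightarrow> f x y = g {x, y}"
  shows "edge_sum E f = (\<Sum>e\<in>E. g e)"
proof -
  let ?S = "{p. {fst p, snd p} \<in> E}"
  have "(\<Sum>(x, y)\<in>{(x, y). {x, y} \<in> E}. f x y) = (\<Sum>p\<in>?S. g {fst p, snd p})"
    using assms(2) by (intro sum.cong) (auto simp: case_prod_beta)
  also have "\<dots> = (\<Sum>e\<in>E. \<Sum>p | p \<in> ?S \<and> {fst p, snd p} = e. g {fst p, snd p})"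
    by (rule sum.group [symmetric]) auto
  also have "\<dots> = (\<Sum>e\<in>E. 2 * g e)"
  proof (rule sum.cong [OF refl])
    fix e assume e: "e \<in> E"
    then obtain x y where xy: "e = {x, y}" "x \<noteq> y"
      using assms(1) by (meson card_2_iff)
    have "{p. p \<in> ?S \<and> {fst p, snd p} = e} = {(x, y), (y, x)}"
      using xy e by (auto simp: doubleton_eq_iff insert_commute)
    then show "(\<Sum>p | p \<in> ?S \<and> {fst p, snd p} = e. g {fst p, snd p}) = 2 * g e"
      using xy by (simp add: insert_commute)
  qed
  finally show ?thesis
    by (simp add: edge_sum_def flip: sum_distrib_left)
qed

text \<open>
  A pair of a \<open>C\<^sup>1\<close> curve of positive densities from \<open>\<mu>\<close> to \<open>\<nu>\<close> and a measurable field solving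
  the continuity equation. Derivatives at the endpoints of the unit interval are one-sided.
\<close>

definition admissible ::
  "'v::finite set set \<Rightarrow> ('v \<Rightarrow> 'v \<Rightarrow> real) \<Rightarrow> real^'v \<Rightarrow> real^'v \<Rightarrow> real^'v \<Rightarrow>
   (real \<Rightarrow> real^'v) \<Rightarrow> (real \<Rightarrow> real^'v) \<Rightarrow> bool" where
  "admissible E w \<pi> \<mu> \<nu> \<rho> \<psi> \<longleftrightarrow>
     (\<forall>t\<in>{0..1}. \<rho> t \<in> positive_densities) \<and> \<rho> 0 = \<mu> \<and> \<rho> 1 = \<nu> \<and>
     \<psi> \<in> borel_measurable (restrict_space borel {0..1}) \<and>
     (\<exists>\<rho>'. continuous_on {0..1} \<rho>' \<and>
        (\<forall>t\<in>{0..1}. (\<rho> has_vector_derivative \<rho>' t) (at t within {0..1})) \<and>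
        (\<forall>t\<in>{0..1}. \<forall>x.
           \<rho>' t $ x + (\<Sum>y | {x, y} \<in> E.
             w x y * (\<psi> t $ y - \<psi> t $ x) * log_mean (\<rho> t $ x / \<pi> $ x) (\<rho> t $ y / \<pi> $ y)) = 0))"

definition action ::
  "'v::finite set set \<Rightarrow> ('v \<Rightarrow> 'v \<Rightarrow> real) \<Rightarrow> real^'v \<Rightarrow>
   (real \<Rightarrow> real^'v) \<Rightarrow> (real \<Rightarrow> real^'v) \<Rightarrow> ennreal" where
  "action E w \<pi> \<rho> \<psi> =
     (\<integral>\<^sup>+t\<in>{0..1}. ennreal (edge_sum E (\<lambda>x y.
        w x y * (\<psi> t $ x - \<psi> t $ y)\<^sup>2 * log_mean (\<rho> t $ x / \<pi> $ x) (\<rho> t $ y / \<pi> $ y))) \<partial>lborel)"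

text \<open>
  The infimum is taken in the extended nonnegative reals, where the infimum of the empty set
  is \<open>\<infinity>\<close>; it is finite for positive densities on a connected graph.
\<close>

definition transport_cost ::
  "'v::finite set set \<Rightarrow> ('v \<Rightarrow> 'v \<Rightarrow> real) \<Rightarrow> real^'v \<Rightarrow> real^'v \<Rightarrow> real^'v \<Rightarrow> ennreal" where
  "transport_cost E w \<pi> \<mu> \<nu> = (INF (\<rho>, \<psi>) \<in> {(\<rho>, \<psi>). admissible E w \<pi> \<mu> \<nu> \<rho> \<psi>}. action E w \<pi> \<rho> \<psi>)"

definition transport_dist ::
  "'v::finite set set \<Rightarrow> ('v \<Rightarrow> 'v \<Rightarrow> real) \<Rightarrow> real^'v \<Rightarrow> real^'v \<Rightarrow> real^'v \<Rightarrow> real" where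
  "transport_dist E w \<pi> \<mu> \<nu> = sqrt (enn2real (transport_cost E w \<pi> \<mu> \<nu>))"

end

theory Submission
  imports Defs
begin

text \<open>
  The logarithmic mean lies between the minimum and the maximum of its arguments, so along a curve
  of densities at distance \<open>O(\<epsilon>)\<close> from \<open>\<pi>\<close> the reweighted Laplacian differs from
  \<open>L\<^sub>w\<close> by a factor \<open>1 + O(\<epsilon>)\<close>.  For the upper bound one takes the straight segment from
  \<open>\<pi>\<close> to \<open>\<pi> + \<epsilon>h\<close>, where the optimal potential solves a Laplace equation.
  For the lower bound, testing the continuity equation against a fixed function and applying Young's
  inequality bounds the action from below.  Since \<open>\<theta> \<le> 1 / min \<pi>\<close> for all
  densities, this first shows that a curve of action \<open>O(\<epsilon>\<^sup>2)\<close> stays within \<open>O(\<epsilon>)\<close> of \<open>\<pi>\<close>; there the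
  test function \<open>L\<^sub>w\<^sup>\<dagger> h\<close> gives the sharp constant.
\<close>

section \<open>The logarithmic mean\<close>

text \<open>An integral over a compact interval of a jointly continuous integrand is continuous in
  the parameter; positivity keeps \<open>powr\<close> continuous. This makes the reweighted edge
  weights continuous along a curve of positive densities.\<close>

lemma continuous_on_log_mean [continuous_intros]:
  fixes f g :: "real \<Rightarrow> real"
  assumes "continuous_on U f" "continuous_on U g" "\<And>t. t \<in> U \<Longrightarrow> f t > 0" "\<And>t. t \<in> U \<Longrightarrow> g t > 0"
  shows "continuous_on U (\<lambda>t. log_mean (f t) (g t))"
proof -
  have f: "continuous_on (U \<times> {0..1}) (\<lambda>p. f (fst p))"
    and g: "continuous_on (U \<times> {0..1}) (\<lambda>p. g (fst p))"
    by (rule continuous_on_compose2[OF assms(1) continuous_on_fst[OF continuous_on_id]]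
        continuous_on_compose2[OF assms(2) continuous_on_fst[OF continuous_on_id]]; auto)+
  have "continuous_on (U \<times> cbox 0 1) (\<lambda>(t, s). f t powr (1 - s) * g t powr s)"
    unfolding case_prod_beta box_real
    by (intro continuous_on_mult continuous_on_powr continuous_on_diff continuous_on_const
        continuous_on_snd continuous_on_id f g) (auto simp: assms(3,4)[THEN less_imp_neq, THEN not_sym])
  from integral_continuous_on_param[OF this] show ?thesis
    by (simp add: log_mean_def)
qed

lemma log_mean_integrable:
  fixes a b :: real
  assumes "a > 0" "b > 0"
  shows "(\<lambda>s. a powr (1 - s) * b powr s) integrable_on {0..1}"
  using assms by (intro integrable_continuous_real continuous_intros) auto

text \<open>The integrand is a weighted geometric mean, monotone in both arguments and equal to
  \<open>M\<close> when both are \<open>M\<close>. The lower bound below is the mirror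
  image.\<close>

lemma log_mean_le:
  assumes "0 < a" "0 < b" "a \<le> M" "b \<le> M"
  shows "log_mean a b \<le> M"
proof -
  have "a powr (1 - s) * b powr s \<le> M" if "s \<in> {0..1}" for s
  proof -
    have "a powr (1 - s) * b powr s \<le> M powr (1 - s) * M powr s"
      using assms that by (intro mult_mono powr_mono2) auto
    also have "\<dots> = M"
      using assms by (simp flip: powr_add)
    finally show ?thesis .
  qed
  then have "log_mean a b \<le> integral {0..1::real} (\<lambda>_. M)"
    unfolding log_mean_def using assms by (intro integral_le log_mean_integrable) auto
  then show ?thesis by simp
qed

lemma log_mean_ge:
  assumes "0 < m" "m \<le> a" "m \<le> b"
  shows "m \<le> log_mean a b"
proof -
  have "m \<le> a powr (1 - s) * b powr s" if "s \<in> {0..1}" for s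
  proof -
    have "m = m powr (1 - s) * m powr s"
      using assms by (simp flip: powr_add)
    also have "\<dots> \<le> a powr (1 - s) * b powr s"
      using assms that by (intro mult_mono powr_mono2) auto
    finally show ?thesis .
  qed
  then have "integral {0..1::real} (\<lambda>_. m) \<le> log_mean a b"
    unfolding log_mean_def using assms by (intro integral_le log_mean_integrable) auto
  then show ?thesis by simp
qed

lemma log_mean_pos: "0 < a \<Longrightarrow> 0 < b \<Longrightarrow> 0 < log_mean a b"
  using log_mean_ge[of "min a b" a b] by linarith

lemma log_mean_self: "0 < a \<Longrightarrow> log_mean a a = a"
  using log_mean_ge[of a a a] log_mean_le[of a a a] by linarith

text \<open>The substitution of 1 - s for s, done as a reflection followed by a unit shift.\<close>

lemma log_mean_commute: "log_mean a b = log_mean b a"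
proof -
  let ?f = "\<lambda>s. a powr (1 - s) * b powr s"
  have "integral {0..1} ?f = integral {-1..0} (\<lambda>s. ?f (- s))"
    using Henstock_Kurzweil_Integration.integral_reflect_real[of 1 0 ?f] by simp
  also have "\<dots> = integral {-1 - (-1)..0 - (-1)} (\<lambda>s. ?f (- (s + -1)))"
    by (rule integral_shift_real_ivl[symmetric])
  also have "\<dots> = integral {0..1} (\<lambda>s. b powr (1 - s) * a powr s)"
    by (simp add: mult.commute)
  finally show ?thesis
    by (simp add: log_mean_def)
qed

section \<open>The Dirichlet form\<close>

text \<open>The energy form of the network with conductances \<open>c\<close>. Leaving
  \<open>c\<close> free allows the forms of \<open>w\<close> and of its reweightings to be
  compared.\<close>

definition dirichlet ::
  "'v::finite set set \<Rightarrow> ('v \<Rightarrow> 'v \<Rightarrow> real) \<Rightarrow> real^'v \<Rightarrow> real^'v \<Rightarrow> real" where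
  "dirichlet E c u v = edge_sum E (\<lambda>x y. c x y * ((u $ x - u $ y) * (v $ x - v $ y)))"

lemma laplacian_nth:
  "(laplacian E c *v v) $ x = (\<Sum>y | {x, y} \<in> E. c x y * (v $ x - v $ y))"
proof -
  have "(laplacian E c *v v) $ x =
      (\<Sum>y\<in>UNIV. (if x = y then wdeg E c x * v $ y else 0) - (if {x, y} \<in> E then c x y * v $ y else 0))"
    unfolding laplacian_def degree_matrix_def adjacency_matrix_def matrix_vector_mult_def
    by (auto simp: left_diff_distrib intro!: sum.cong)
  also have "\<dots> = wdeg E c x * v $ x - (\<Sum>y | {x, y} \<in> E. c x y * v $ y)"
    by (simp add: sum_subtractf sum.delta' flip: sum.inter_filter)
  finally show ?thesis
    by (simp add: wdeg_def sum_distrib_right sum_subtractf right_diff_distrib)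
qed

text \<open>Summation by parts: swapping the two ends of every ordered edge gives a second
  expression for the inner product, and adding both produces the product of differences.\<close>

lemma inner_laplacian:
  assumes "weighted_graph E c"
  shows "u \<bullet> (laplacian E c *v v) = dirichlet E c u v"
proof -
  let ?P = "{(x, y). {x, y} \<in> E}"
  have sym: "c x y = c y x" if "{x, y} \<in> E" for x y
    using assms that unfolding weighted_graph_def by blast
  have P: "?P = Sigma UNIV (\<lambda>x. {y. {x, y} \<in> E})"
    by auto
  have 1: "u \<bullet> (laplacian E c *v v) = (\<Sum>(x, y)\<in>?P. u $ x * (c x y * (v $ x - v $ y)))"
    unfolding P by (simp add: inner_vec_def laplacian_nth sum_distrib_left sum.Sigma)
  also have "\<dots> = (\<Sum>(x, y)\<in>?P. u $ y * (c x y * (v $ y - v $ x)))"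
    by (rule sum.reindex_bij_witness[of _ prod.swap prod.swap]) (auto simp: insert_commute sym)
  finally have 2: "u \<bullet> (laplacian E c *v v) = (\<Sum>(x, y)\<in>?P. u $ y * (c x y * (v $ y - v $ x)))" .
  have "2 * (u \<bullet> (laplacian E c *v v)) =
      (\<Sum>(x, y)\<in>?P. c x y * ((u $ x - u $ y) * (v $ x - v $ y)))"
    unfolding mult_2
    by (subst 1, subst 2) (auto simp: algebra_simps simp flip: sum.distrib intro!: sum.cong)
  then show ?thesis
    by (simp add: dirichlet_def edge_sum_def)
qed

lemma edge_sum_mono: "(\<And>x y. {x, y} \<in> E \<Longrightarrow> f x y \<le> g x y) \<Longrightarrow> edge_sum E f \<le> edge_sum E g"
  unfolding edge_sum_def by (intro divide_right_mono sum_mono) auto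

lemma edge_sum_linear:
  "edge_sum E (\<lambda>x y. a * f x y + b * g x y) = a * edge_sum E f + b * edge_sum E g"
  unfolding edge_sum_def
  by (simp add: case_prod_beta sum.distrib sum_distrib_left add_divide_distrib)

lemma edge_sum_cmult: "edge_sum E (\<lambda>x y. a * f x y) = a * edge_sum E f"
  using edge_sum_linear[of E a f 0 f] by simp

lemma dirichlet_mono:
  assumes "\<And>x y. {x, y} \<in> E \<Longrightarrow> c x y \<le> k * d x y"
  shows "dirichlet E c u u \<le> k * dirichlet E d u u"
  unfolding dirichlet_def edge_sum_cmult[symmetric]
proof (rule edge_sum_mono)
  fix x y assume "{x, y} \<in> E"
  from mult_right_mono[OF assms[OF this] zero_le_square[of "u $ x - u $ y"]]
  show "c x y * ((u $ x - u $ y) * (u $ x - u $ y)) \<le> k * (d x y * ((u $ x - u $ y) * (u $ x - u $ y)))"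
    by (simp add: mult.assoc)
qed

lemma dirichlet_nonneg:
  assumes "weighted_graph E c"
  shows "0 \<le> dirichlet E c u u"
proof -
  have "edge_sum E (\<lambda>x y. 0) \<le> dirichlet E c u u"
    unfolding dirichlet_def
    using assms by (intro edge_sum_mono mult_nonneg_nonneg[OF _ zero_le_square])
      (simp add: weighted_graph_def less_imp_le)
  then show ?thesis
    by (simp add: edge_sum_def)
qed

text \<open>Nonnegativity of \<open>c x y * (p - q)\<^sup>2\<close> on each edge, summed over the
  edges.\<close>

lemma dirichlet_young:
  assumes "weighted_graph E c"
  shows "2 * dirichlet E c u v \<le> dirichlet E c u u + dirichlet E c v v"
proof -
  \<comment> \<open>The factors 1 give the right-hand side the shape that
    \<open>edge_sum_linear\<close> rewrites.\<close>
  have "2 * (c x y * (p * q)) \<le> 1 * (c x y * (p * p)) + 1 * (c x y * (q * q))"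
    if "{x, y} \<in> E" for x y p q
  proof -
    have "0 \<le> c x y * (p - q)\<^sup>2"
      using assms that by (simp add: weighted_graph_def less_imp_le)
    then show ?thesis
      by (simp add: power2_eq_square algebra_simps)
  qed
  then have "edge_sum E (\<lambda>x y. 2 * (c x y * ((u $ x - u $ y) * (v $ x - v $ y)))) \<le>
      edge_sum E (\<lambda>x y. 1 * (c x y * ((u $ x - u $ y) * (u $ x - u $ y))) +
                          1 * (c x y * ((v $ x - v $ y) * (v $ x - v $ y))))"
    by (intro edge_sum_mono)
  then show ?thesis
    unfolding edge_sum_linear edge_sum_cmult dirichlet_def by simp
qed

lemma dirichlet_scale [simp]:
  "dirichlet E c (a *\<^sub>R u) v = a * dirichlet E c u v"
  "dirichlet E c u (a *\<^sub>R v) = a * dirichlet E c u v"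
  unfolding dirichlet_def edge_sum_cmult[symmetric] by (simp_all add: algebra_simps)

lemma dirichlet_le_norm:
  fixes E :: "'v::finite set set"
  assumes "weighted_graph E c"
  obtains B where "B > 0" "\<And>u. dirichlet E c u u \<le> B * (norm u)\<^sup>2"
proof -
  obtain B where B: "B > 0" "\<And>u. norm (laplacian E c *v u) \<le> norm u * B"
    using bounded_linear.pos_bounded[OF matrix_vector_mul_bounded_linear[of "laplacian E c"]] by blast
  have "dirichlet E c u u \<le> B * (norm u)\<^sup>2" for u
  proof -
    have "dirichlet E c u u \<le> norm u * norm (laplacian E c *v u)"
      unfolding inner_laplacian[OF assms, symmetric] by (rule norm_cauchy_schwarz)
    also have "\<dots> \<le> norm u * (norm u * B)"
      by (intro mult_left_mono B) auto
    finally show ?thesis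
      by (simp add: power2_eq_square mult_ac)
  qed
  with B(1) show thesis
    by (rule that)
qed

text \<open>A vanishing sum of nonnegative terms forces equal values across each edge, since the
  weights are positive; equality then propagates along a path.\<close>

lemma dirichlet_zero_imp_constant:
  assumes "weighted_graph E c" "connected_graph E" "dirichlet E c u u = 0"
  shows "u $ x = u $ y"
proof -
  have nn: "0 \<le> c x y * ((u $ x - u $ y) * (u $ x - u $ y))" if "{x, y} \<in> E" for x y
    using assms(1) that by (simp add: weighted_graph_def less_imp_le)
  have "(\<Sum>(x, y)\<in>{(x, y). {x, y} \<in> E}. c x y * ((u $ x - u $ y) * (u $ x - u $ y))) = 0"
    using assms(3) by (simp add: dirichlet_def edge_sum_def)
  then have "\<forall>(x, y)\<in>{(x, y). {x, y} \<in> E}. c x y * ((u $ x - u $ y) * (u $ x - u $ y)) = 0"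
    using nn by (subst (asm) sum_nonneg_eq_0_iff) auto
  then have edge: "u $ x = u $ y" if "{x, y} \<in> E" for x y
    using that assms(1) by (force simp: weighted_graph_def)
  have "(x, y) \<in> {(a, b). {a, b} \<in> E}\<^sup>*"
    using assms(2) by (simp add: connected_graph_def)
  then show ?thesis
  proof induction
    case (step y z)
    then have "{y, z} \<in> E" by simp
    with edge step.IH show ?case by metis
  qed simp
qed

section \<open>The pseudoinverse of the Laplacian\<close>

text \<open>Penrose's uniqueness argument: symmetry of the products identifies \<open>A ** X\<close>
  with \<open>A ** Y\<close> and \<open>X ** A\<close> with \<open>Y ** A\<close>, whence Y = YAY =
  XAY = XAX = X.\<close>

lemma pseudo_inverse_eqI:
  assumes X: "is_pseudo_inverse A X"
  shows "pseudo_inverse A = X"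
  unfolding pseudo_inverse_def
proof (rule the_equality)
  fix Y assume Y: "is_pseudo_inverse A Y"
  note X' = X[unfolded is_pseudo_inverse_def] and Y' = Y[unfolded is_pseudo_inverse_def]
  have "A ** X = transpose ((A ** Y) ** (A ** X))"
    using X' Y' by (metis matrix_mul_assoc)
  also have "\<dots> = (A ** X) ** (A ** Y)"
    using X' Y' by (simp add: matrix_transpose_mul)
  also have "\<dots> = A ** Y"
    using X' by (metis matrix_mul_assoc)
  finally have AX: "A ** X = A ** Y" .
  have "X ** A = transpose ((X ** A) ** (Y ** A))"
    using X' Y' by (metis matrix_mul_assoc)
  also have "\<dots> = (Y ** A) ** (X ** A)"
    using X' Y' by (simp add: matrix_transpose_mul)
  also have "\<dots> = Y ** A"
    using X' by (metis matrix_mul_assoc)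
  finally have XA: "X ** A = Y ** A" .
  have "Y = (Y ** A) ** Y"
    using Y' by simp
  also have "\<dots> = X ** (A ** Y)"
    by (simp add: XA matrix_mul_assoc)
  also have "\<dots> = X"
    using X' by (simp add: matrix_mul_assoc flip: AX)
  finally show "Y = X" .
qed (rule X)

text \<open>The orthogonal projection onto the constant vectors, which form the kernel of the
  Laplacian of a connected graph; adding it makes the Laplacian invertible.\<close>

definition averaging :: "real^'v^'v::finite" where
  "averaging = (\<chi> x y. 1 / real CARD('v))"

lemma matrix_add_rdistrib: "(A + B) ** C = A ** C + B ** C"
  by (simp add: matrix_matrix_mult_def vec_eq_iff sum.distrib distrib_right)

lemma averaging_nth: "(averaging *v u) $ x = (\<Sum>y\<in>UNIV. u $ y) / real CARD('v)"
  for u :: "real^'v::finite"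
  by (simp add: averaging_def matrix_vector_mult_def sum_divide_distrib)

lemma averaging_zero_sum: "h \<in> zero_sum \<Longrightarrow> averaging *v h = 0"
  by (simp add: vec_eq_iff averaging_nth zero_sum_def)

lemma transpose_averaging: "transpose averaging = averaging"
  by (simp add: averaging_def transpose_def vec_eq_iff)

lemma averaging_idem: "averaging ** averaging = (averaging :: real^'v^'v::finite)"
  by (simp add: averaging_def matrix_matrix_mult_def vec_eq_iff)

lemma transpose_laplacian:
  assumes "weighted_graph E c"
  shows "transpose (laplacian E c) = laplacian E c"
  using assms
  by (auto simp: laplacian_def degree_matrix_def adjacency_matrix_def transpose_def vec_eq_iff
      weighted_graph_def insert_commute)

lemma laplacian_averaging: "laplacian E c ** averaging = 0"
proof -
  have "laplacian E c *v (averaging *v u) = 0" for u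
    by (simp add: vec_eq_iff laplacian_nth averaging_nth)
  then show ?thesis
    by (simp add: matrix_eq matrix_vector_mul_assoc)
qed

lemma averaging_laplacian:
  assumes "weighted_graph E c"
  shows "averaging ** laplacian E c = 0"
  using arg_cong[OF laplacian_averaging[of E c], of transpose]
  by (simp add: matrix_transpose_mul transpose_averaging transpose_laplacian[OF assms])
    (simp add: transpose_def vec_eq_iff)

text \<open>Averaging a kernel equation annihilates the Laplacian term, so the kernel vector has
  mean zero. It then has zero energy, hence is constant, hence zero.\<close>

lemma invertible_laplacian_averaging:
  assumes "weighted_graph E c" "connected_graph E"
  shows "invertible (laplacian E c + averaging)"
  unfolding invertible_left_inverse matrix_left_invertible_ker
proof (intro allI impI)
  fix u assume u: "(laplacian E c + averaging) *v u = 0"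
  then have "averaging *v (laplacian E c *v u + averaging *v u) = 0"
    by (simp add: matrix_vector_mult_add_rdistrib)
  then have Ju: "averaging *v u = 0"
    by (simp add: matrix_vector_right_distrib matrix_vector_mul_assoc averaging_idem
        averaging_laplacian[OF assms(1)])
  with u have "laplacian E c *v u = 0"
    by (simp add: matrix_vector_mult_add_rdistrib)
  then have "dirichlet E c u u = 0"
    by (simp flip: inner_laplacian[OF assms(1)])
  then have const: "u $ x = u $ y" for x y
    by (rule dirichlet_zero_imp_constant[OF assms])
  have "u $ x = 0" for x
  proof -
    have "(averaging *v u) $ x = (\<Sum>y\<in>(UNIV::'a set). u $ x) / real CARD('a)"
      unfolding averaging_nth by (intro arg_cong2[where f="(/)"] sum.cong const refl)
    then show ?thesis using Ju by simp
  qed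
  then show "u = 0" by (simp add: vec_eq_iff)
qed

text \<open>If \<open>N\<close> inverts \<open>?L + ?J\<close>, the pseudoinverse is
  \<open>N - ?J\<close>: \<open>N\<close> fixes the constants, and subtracting \<open>?J\<close>
  sends them to zero. Both products with \<open>?L\<close> are the symmetric projection onto
  zero-sum vectors.\<close>

lemma laplacian_pseudo_inverse:
  assumes "weighted_graph E c" "connected_graph E"
  shows "laplacian E c ** pseudo_inverse (laplacian E c) = mat 1 - averaging"
proof -
  let ?L = "laplacian E c" and ?J = "averaging :: real^'a^'a"
  obtain N where N: "(?L + ?J) ** N = mat 1" "N ** (?L + ?J) = mat 1"
    using invertible_laplacian_averaging[OF assms] unfolding invertible_def by blast
  note L = laplacian_averaging[of E c] averaging_laplacian[OF assms(1)] averaging_idem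
  have JN: "?J ** N = ?J"
  proof -
    have "?J = ?J ** ((?L + ?J) ** N)" by (simp add: N)
    also have "\<dots> = ?J ** N" by (simp add: matrix_mul_assoc matrix_add_ldistrib L)
    finally show ?thesis by simp
  qed
  have NJ: "N ** ?J = ?J"
  proof -
    have "?J = (N ** (?L + ?J)) ** ?J" by (simp add: N)
    also have "\<dots> = N ** ?J" by (simp add: matrix_add_rdistrib L flip: matrix_mul_assoc)
    finally show ?thesis by simp
  qed
  have LN: "?L ** N = mat 1 - ?J"
    using N(1) by (simp add: matrix_add_rdistrib JN eq_diff_eq)
  have NL: "N ** ?L = mat 1 - ?J"
    using N(2) by (simp add: matrix_add_ldistrib NJ eq_diff_eq)
  have dl: "A ** (B - C) = A ** B - A ** C" and dr: "(B - C) ** A = B ** A - C ** A"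
    for A B C :: "real^'a^'a"
    by (simp_all add: matrix_matrix_mult_def vec_eq_iff sum_subtractf algebra_simps)
  have LX: "?L ** (N - ?J) = mat 1 - ?J" and XL: "(N - ?J) ** ?L = mat 1 - ?J"
    by (simp_all add: dl dr LN NL L)
  have "transpose (mat 1 - ?J) = mat 1 - ?J"
    by (simp add: averaging_def transpose_def mat_def vec_eq_iff)
  then have "is_pseudo_inverse ?L (N - ?J)"
    unfolding is_pseudo_inverse_def LX XL by (simp add: dl dr JN L)
  then show ?thesis
    by (simp add: pseudo_inverse_eqI LX)
qed

lemma laplacian_pseudo_inverse_mult:
  assumes "weighted_graph E c" "connected_graph E" "h \<in> zero_sum"
  shows "laplacian E c *v (pseudo_inverse (laplacian E c) *v h) = h"
  by (simp add: matrix_vector_mul_assoc laplacian_pseudo_inverse[OF assms(1,2)]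
      matrix_vector_mult_diff_rdistrib averaging_zero_sum[OF assms(3)])

text \<open>Reduces the singular Laplace equation to an invertible system: averaging both sides
  shows that the extra term vanishes when the right-hand side has zero sum.\<close>

lemma laplacian_solveI:
  assumes "weighted_graph E c" "(laplacian E c + averaging) *v u = h" "h \<in> zero_sum"
  shows "laplacian E c *v u = h"
proof -
  have "averaging *v (laplacian E c *v u + averaging *v u) = averaging *v h"
    using assms(2) by (simp add: matrix_vector_mult_add_rdistrib)
  then have "averaging *v u = 0"
    by (simp add: matrix_vector_right_distrib matrix_vector_mul_assoc averaging_idem
        averaging_laplacian[OF assms(1)] averaging_zero_sum[OF assms(3)])
  with assms(2) show ?thesis
    by (simp add: matrix_vector_mult_add_rdistrib)
qed

section \<open>Continuous dependence of solutions of linear systems on the matrix\<close>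

lemma continuous_on_det [continuous_intros]:
  fixes A :: "'a::topological_space \<Rightarrow> real^'n^'n"
  assumes "\<And>i j. continuous_on S (\<lambda>t. A t $ i $ j)"
  shows "continuous_on S (\<lambda>t. det (A t))"
  unfolding det_def by (intro continuous_intros assms)

text \<open>Cramer's rule writes the solution as quotients of determinants, continuous in the
  entries with nonvanishing denominators.\<close>

lemma continuous_on_linear_solve:
  fixes A :: "'a::topological_space \<Rightarrow> real^'n^'n"
  assumes A: "\<And>i j. continuous_on S (\<lambda>t. A t $ i $ j)" and inv: "\<And>t. t \<in> S \<Longrightarrow> invertible (A t)"
  obtains u where "continuous_on S u" "\<And>t. t \<in> S \<Longrightarrow> A t *v u t = b"
proof
  let ?u = "\<lambda>t. \<chi> k. det (\<chi> i j. if j = k then b $ i else A t $ i $ j) / det (A t)"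
  show "A t *v ?u t = b" if "t \<in> S" for t
    using inv[OF that] by (subst cramer) (auto simp: invertible_det_nz)
  have entry: "continuous_on S (\<lambda>t. (\<chi> i j. if j = k then b $ i else A t $ i $ j) $ i $ j)" for i j k
    by (cases "j = k") (simp_all add: A)
  show "continuous_on S ?u"
    using inv by (intro continuous_on_vec_lambda continuous_on_divide continuous_on_det entry A)
      (simp add: invertible_det_nz)
qed

section \<open>Reweighted graphs\<close>

lemma positive_densities_pos: "\<mu> \<in> positive_densities \<Longrightarrow> 0 < \<mu> $ x"
  by (simp add: positive_densities_def)

lemma positive_densities_sum: "\<mu> \<in> positive_densities \<Longrightarrow> (\<Sum>x\<in>UNIV. \<mu> $ x) = 1"
  by (simp add: positive_densities_def densities_def)

lemma positive_densities_le_1: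
  assumes "\<mu> \<in> positive_densities"
  shows "\<mu> $ x \<le> 1"
proof -
  have "\<mu> $ x \<le> (\<Sum>y\<in>UNIV. \<mu> $ y)"
    by (rule member_le_sum) (auto intro: less_imp_le positive_densities_pos[OF assms])
  then show ?thesis
    by (simp add: positive_densities_sum[OF assms])
qed

lemma positive_densities_lower_bound:
  assumes "\<mu> \<in> positive_densities"
  obtains p where "0 < p" "\<And>x. p \<le> \<mu> $ x"
proof
  show "0 < Min (range (($) \<mu>))"
    by (subst Min_gr_iff) (auto simp: positive_densities_pos[OF assms])
  show "Min (range (($) \<mu>)) \<le> \<mu> $ x" for x
    by (rule Min_le) auto
qed

lemma weighted_graph_reweight:
  assumes "weighted_graph E w" "\<pi> \<in> positive_densities" "\<mu> \<in> positive_densities"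
  shows "weighted_graph E (reweight w \<pi> \<mu>)"
proof -
  have "0 < log_mean (\<mu> $ x / \<pi> $ x) (\<mu> $ y / \<pi> $ y)" for x y
    using assms(2,3) by (intro log_mean_pos divide_pos_pos positive_densities_pos)
  then show ?thesis
    using assms(1) by (auto simp: weighted_graph_def reweight_def log_mean_commute)
qed

text \<open>Bounds on the density ratios at the vertices pass to the edges because the logarithmic
  mean lies between its arguments; likewise for \<open>reweight_ge\<close>.\<close>

lemma reweight_le:
  assumes "weighted_graph E w" "\<pi> \<in> positive_densities" "\<mu> \<in> positive_densities" "{x, y} \<in> E"
    and "\<And>x. \<mu> $ x / \<pi> $ x \<le> M"
  shows "reweight w \<pi> \<mu> x y \<le> M * w x y"
proof -
  have "log_mean (\<mu> $ x / \<pi> $ x) (\<mu> $ y / \<pi> $ y) \<le> M"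
    using assms(2,3,5) by (intro log_mean_le divide_pos_pos positive_densities_pos)
  moreover have "0 < w x y"
    using assms(1,4) by (simp add: weighted_graph_def)
  ultimately show ?thesis
    by (simp add: reweight_def mult.commute)
qed

lemma reweight_ge:
  assumes "weighted_graph E w" "{x, y} \<in> E" "0 < m" "\<And>x. m \<le> \<mu> $ x / \<pi> $ x"
  shows "m * w x y \<le> reweight w \<pi> \<mu> x y"
proof -
  have "m \<le> log_mean (\<mu> $ x / \<pi> $ x) (\<mu> $ y / \<pi> $ y)"
    using assms(3,4) by (intro log_mean_ge)
  moreover have "0 < w x y"
    using assms(1,2) by (simp add: weighted_graph_def)
  ultimately show ?thesis
    by (simp add: reweight_def mult.commute)
qed

lemma reweight_self: "\<pi> \<in> positive_densities \<Longrightarrow> reweight w \<pi> \<pi> = w"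
  using positive_densities_pos[of \<pi>] by (auto simp: fun_eq_iff reweight_def log_mean_self less_imp_neq[THEN not_sym])

lemma action_eq_dirichlet:
  "action E w \<pi> \<rho> \<psi> =
    (\<integral>\<^sup>+t\<in>{0..1}. ennreal (dirichlet E (reweight w \<pi> (\<rho> t)) (\<psi> t) (\<psi> t)) \<partial>lborel)"
  by (simp add: action_def dirichlet_def reweight_def power2_eq_square mult_ac)

text \<open>The flux sum is minus the reweighted Laplacian of the potential, so the continuity
  equation is one Laplace equation at each time.\<close>

lemma continuity_equation_iff:
  "(\<forall>x. r $ x + (\<Sum>y | {x, y} \<in> E. w x y * (u $ y - u $ x) *
      log_mean (\<mu> $ x / \<pi> $ x) (\<mu> $ y / \<pi> $ y)) = 0) \<longleftrightarrow> r = laplacian E (reweight w \<pi> \<mu>) *v u"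
proof -
  have "(\<Sum>y | {x, y} \<in> E. w x y * (u $ y - u $ x) * log_mean (\<mu> $ x / \<pi> $ x) (\<mu> $ y / \<pi> $ y)) =
      - (laplacian E (reweight w \<pi> \<mu>) *v u) $ x" for x
    unfolding laplacian_nth reweight_def sum_negf[symmetric]
    by (intro sum.cong) (simp_all add: algebra_simps)
  then show ?thesis
    by (simp add: vec_eq_iff)
qed

section \<open>Lower bound\<close>

text \<open>\<open>ennreal\<close> truncates negative values to 0, so the right-hand side integrates
  the positive part. Integrability makes it finite, which allows \<open>enn2real\<close> to be
  undone.\<close>

lemma ennreal_integral_le_nn_integral:
  fixes f :: "'a \<Rightarrow> real"
  assumes "integrable M f"
  shows "ennreal (integral\<^sup>L M f) \<le> (\<integral>\<^sup>+x. ennreal (f x) \<partial>M)"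
proof -
  have "integral\<^sup>L M f \<le> enn2real (\<integral>\<^sup>+x. ennreal (f x) \<partial>M)"
    by (simp add: real_lebesgue_integral_def[OF assms])
  then have "ennreal (integral\<^sup>L M f) \<le> ennreal (enn2real (\<integral>\<^sup>+x. ennreal (f x) \<partial>M))"
    by (rule ennreal_leI)
  also have "\<dots> = (\<integral>\<^sup>+x. ennreal (f x) \<partial>M)"
    using assms by (intro ennreal_enn2real) (auto simp: real_integrable_def top.not_eq_extremum)
  finally show ?thesis .
qed

text \<open>By the continuity equation and Young's inequality, twice the derivative of
  \<open>\<phi> \<bullet> \<rho> t\<close> is at most \<open>B\<close> plus the integrand of the
  action; integrate over \<open>{0..T}\<close>. A free end time \<open>T\<close> gives control of
  the whole curve, not only of its endpoint.\<close>

lemma action_ge_test_function: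
  assumes G: "weighted_graph E w" and \<pi>: "\<pi> \<in> positive_densities"
    and adm: "admissible E w \<pi> \<mu> \<nu> \<rho> \<psi>" and T: "T \<in> {0..1}"
    and B: "\<And>t. t \<in> {0..1} \<Longrightarrow> dirichlet E (reweight w \<pi> (\<rho> t)) \<phi> \<phi> \<le> B"
  shows "ennreal (2 * (\<phi> \<bullet> (\<rho> T - \<mu>)) - B) \<le> action E w \<pi> \<rho> \<psi>"
proof -
  obtain \<rho>' where cont: "continuous_on {0..1} \<rho>'"
    and deriv: "\<And>t. t \<in> {0..1} \<Longrightarrow> (\<rho> has_vector_derivative \<rho>' t) (at t within {0..1})"
    and eqn: "\<And>t. t \<in> {0..1} \<Longrightarrow> \<rho>' t = laplacian E (reweight w \<pi> (\<rho> t)) *v \<psi> t"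
    using adm unfolding admissible_def continuity_equation_iff by blast
  have pos: "\<rho> t \<in> positive_densities" if "t \<in> {0..1}" for t
    using adm that by (simp add: admissible_def)
  have G': "weighted_graph E (reweight w \<pi> (\<rho> t))" if "t \<in> {0..1}" for t
    by (intro weighted_graph_reweight G \<pi> pos that)
  let ?D = "\<lambda>t. dirichlet E (reweight w \<pi> (\<rho> t))"
  let ?f = "\<lambda>t. 2 * (\<phi> \<bullet> \<rho>' t) - B" and ?F = "\<lambda>t. 2 * (\<phi> \<bullet> \<rho> t) - B * t"
  \<comment> \<open>\<open>B\<close> bounds a nonnegative energy, so \<open>B * T\<close> can later
    be enlarged to \<open>B\<close>.\<close>
  have "0 \<le> ?D 0 \<phi> \<phi>"
    by (intro dirichlet_nonneg G') auto
  then have "0 \<le> B"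
    using B[of 0] by auto
  have FTC: "has_bochner_integral lborel (\<lambda>t. indicator {0..T} t *\<^sub>R ?f t) (?F T - ?F 0)"
  proof (rule has_bochner_integral_FTC_Icc)
    show "0 \<le> T" using T by simp
    show "continuous_on {0..T} ?f"
      using T by (intro continuous_intros continuous_on_subset[OF cont]) auto
    fix t assume t: "0 \<le> t" "t \<le> T"
    have "(\<rho> has_vector_derivative \<rho>' t) (at t within {0..T})"
      using t T by (intro has_vector_derivative_within_subset[OF deriv]) auto
    from bounded_linear.has_vector_derivative[OF bounded_linear_inner_right this]
    have "((\<lambda>t. \<phi> \<bullet> \<rho> t) has_real_derivative \<phi> \<bullet> \<rho>' t) (at t within {0..T})"
      by (simp add: has_real_derivative_iff_has_vector_derivative)
    then have "(?F has_real_derivative ?f t) (at t within {0..T})"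
      by (auto intro!: derivative_eq_intros)
    then show "(?F has_vector_derivative ?f t) (at t within {0..T})"
      by (simp add: has_real_derivative_iff_has_vector_derivative)
  qed
  have young: "?f t \<le> ?D t (\<psi> t) (\<psi> t)" if t: "t \<in> {0..1}" for t
    using dirichlet_young[OF G'[OF t], of \<phi> "\<psi> t"] B[OF t]
    by (simp add: eqn[OF t] inner_laplacian[OF G'[OF t]])
  have "\<rho> 0 = \<mu>"
    using adm by (simp add: admissible_def)
  moreover have "B * T \<le> B"
    using T \<open>0 \<le> B\<close> by (simp add: mult_left_le)
  ultimately have "ennreal (2 * (\<phi> \<bullet> (\<rho> T - \<mu>)) - B) \<le> ennreal (?F T - ?F 0)"
    by (intro ennreal_leI) (simp add: inner_diff_right)
  also have "\<dots> = ennreal (LINT t|lborel. indicator {0..T} t *\<^sub>R ?f t)"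
    using FTC by (simp add: has_bochner_integral_integral_eq)
  also have "\<dots> \<le> (\<integral>\<^sup>+t. ennreal (indicator {0..T} t *\<^sub>R ?f t) \<partial>lborel)"
    using FTC by (intro ennreal_integral_le_nn_integral) (simp add: has_bochner_integral_iff)
  also have "\<dots> \<le> action E w \<pi> \<rho> \<psi>"
    unfolding action_eq_dirichlet
    using T young by (intro nn_integral_mono) (auto simp: indicator_def intro!: ennreal_leI)
  finally show ?thesis .
qed

text \<open>The bound is proved for each admissible pair and passes to the infimum. \<open>C\<close>
  is built only from a lower bound of \<pi>, an energy bound and a bound of the pseudoinverse, hence
  is uniform in \<open>h\<close> and \<epsilon>.\<close>

lemma transport_cost_lower_bound:
  fixes E :: "'v::finite set set"
  assumes G: "weighted_graph E w" "connected_graph E" and \<pi>: "\<pi> \<in> positive_densities"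
  obtains C where "C > 0"
    "\<And>h \<epsilon>. h \<in> zero_sum \<Longrightarrow> norm h \<le> 1 \<Longrightarrow>
      ennreal (\<epsilon>\<^sup>2 / (1 + C * \<bar>\<epsilon>\<bar>) * (h \<bullet> (pseudo_inverse (laplacian E w) *v h)))
        \<le> transport_cost E w \<pi> \<pi> (\<pi> + \<epsilon> *\<^sub>R h)"
proof -
  let ?X = "pseudo_inverse (laplacian E w)"
  obtain p where p: "0 < p" "\<And>x. p \<le> \<pi> $ x"
    using positive_densities_lower_bound[OF \<pi>] by blast
  obtain B where B: "0 < B" "\<And>u. dirichlet E w u u \<le> B * (norm u)\<^sup>2"
    using dirichlet_le_norm[OF G(1)] by blast
  obtain \<Lambda> where \<Lambda>: "0 < \<Lambda>" "\<And>h. norm (?X *v h) \<le> norm h * \<Lambda>"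
    using bounded_linear.pos_bounded[OF matrix_vector_mul_bounded_linear[of ?X]] by blast
  \<comment> \<open>\<open>K * \<bar>\<epsilon>\<bar>\<close> will bound the distance of the curve
    from \<pi>; dividing by \<open>p\<close> turns this into a bound on density ratios.\<close>
  define K where "K = sqrt (\<Lambda> * B / p)"
  define C where "C = K / p"
  have K: "0 < K" "K\<^sup>2 = \<Lambda> * B / p"
    using p B \<Lambda> by (auto simp: K_def)
  have "0 < C"
    using K p by (simp add: C_def)
  moreover have "ennreal (\<epsilon>\<^sup>2 / (1 + C * \<bar>\<epsilon>\<bar>) * (h \<bullet> (?X *v h))) \<le> action E w \<pi> \<rho> \<psi>"
    if h: "h \<in> zero_sum" "norm h \<le> 1" and adm: "admissible E w \<pi> \<pi> (\<pi> + \<epsilon> *\<^sub>R h) \<rho> \<psi>" for h \<epsilon> \<rho> \<psi>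
  proof (cases "ennreal (\<epsilon>\<^sup>2 * \<Lambda>) \<le> action E w \<pi> \<rho> \<psi>")
    \<comment> \<open>An action this large satisfies the bound at once, because the quadratic form
      is at most \<open>\<Lambda>\<close> on the unit ball.\<close>
    case True
    have "1 \<le> 1 + C * \<bar>\<epsilon>\<bar>"
      using \<open>0 < C\<close> by simp
    have "h \<bullet> (?X *v h) \<le> norm h * (norm h * \<Lambda>)"
      by (rule order_trans[OF norm_cauchy_schwarz mult_left_mono[OF \<Lambda>(2)]]) simp
    also have "\<dots> \<le> 1 * (1 * \<Lambda>)"
      using h(2) \<Lambda>(1) by (intro mult_mono) auto
    finally have "h \<bullet> (?X *v h) \<le> \<Lambda>" by simp
    then have "\<epsilon>\<^sup>2 / (1 + C * \<bar>\<epsilon>\<bar>) * (h \<bullet> (?X *v h)) \<le> \<epsilon>\<^sup>2 / (1 + C * \<bar>\<epsilon>\<bar>) * \<Lambda>"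
      using \<open>1 \<le> 1 + C * \<bar>\<epsilon>\<bar>\<close> by (intro mult_left_mono) auto
    also have "\<dots> \<le> \<epsilon>\<^sup>2 / 1 * \<Lambda>"
      using \<open>1 \<le> 1 + C * \<bar>\<epsilon>\<bar>\<close> \<Lambda>(1) by (intro mult_right_mono divide_left_mono) auto
    finally show ?thesis
      using True by (simp add: order_trans[OF ennreal_leI])
  next
    case False
    have pos: "\<rho> t \<in> positive_densities" if "t \<in> {0..1}" for t
      using adm that by (simp add: admissible_def)
    have near: "norm (\<rho> T - \<pi>) \<le> K * \<bar>\<epsilon>\<bar>" if T: "T \<in> {0..1}" for T
    proof -
      let ?d = "\<rho> T - \<pi>"
      \<comment> \<open>The factor p/B maximizes 2a|d|^2 - a^2 (B/p)|d|^2 over a, where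
        \<open>d\<close> is the displacement at time \<open>T\<close>. The ratio bound 1/p uses only
        that densities are at most 1.\<close>
      have crude: "dirichlet E (reweight w \<pi> (\<rho> t)) ((p / B) *\<^sub>R ?d) ((p / B) *\<^sub>R ?d) \<le>
          p / B * (norm ?d)\<^sup>2" if t: "t \<in> {0..1}" for t
      proof -
        have "\<rho> t $ x / \<pi> $ x \<le> 1 / p" for x
          using p(1) p(2)[of x] positive_densities_le_1[OF pos[OF t]]
          by (intro frac_le) auto
        then have "dirichlet E (reweight w \<pi> (\<rho> t)) ?d ?d \<le> 1 / p * dirichlet E w ?d ?d"
          by (intro dirichlet_mono reweight_le[OF G(1) \<pi> pos[OF t]])
        also have "\<dots> \<le> 1 / p * (B * (norm ?d)\<^sup>2)"
          using p(1) by (intro mult_left_mono B) auto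
        finally have "p / B * (p / B * dirichlet E (reweight w \<pi> (\<rho> t)) ?d ?d) \<le>
            p / B * (p / B * (1 / p * (B * (norm ?d)\<^sup>2)))"
          using p(1) B(1) by (intro mult_left_mono) auto
        then show ?thesis
          using p(1) B(1) by simp
      qed
      have "ennreal (p / B * (norm ?d)\<^sup>2) =
          ennreal (2 * (((p / B) *\<^sub>R ?d) \<bullet> ?d) - p / B * (norm ?d)\<^sup>2)"
        by (simp add: power2_norm_eq_inner)
      also have "\<dots> \<le> action E w \<pi> \<rho> \<psi>"
        by (rule action_ge_test_function[OF G(1) \<pi> adm T crude])
      also have "\<dots> < ennreal (\<epsilon>\<^sup>2 * \<Lambda>)"
        using False by simp
      finally have "p / B * (norm ?d)\<^sup>2 < \<epsilon>\<^sup>2 * \<Lambda>"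
        using p(1) B(1) by (subst (asm) ennreal_less_iff) auto
      then have "(norm ?d)\<^sup>2 \<le> \<epsilon>\<^sup>2 * (\<Lambda> * B / p)"
        using p(1) B(1) by (simp add: field_simps)
      also have "\<dots> = (K * \<bar>\<epsilon>\<bar>)\<^sup>2"
        unfolding power_mult_distrib K(2) power2_abs by simp
      finally show ?thesis
        by (rule power2_le_imp_le) (simp add: K(1) less_imp_le)
    qed
    define M where "M = 1 + C * \<bar>\<epsilon>\<bar>"
    define f where "f = ?X *v h"
    have "1 \<le> M"
      using \<open>0 < C\<close> by (simp add: M_def)
    have Lf: "laplacian E w *v f = h"
      unfolding f_def by (rule laplacian_pseudo_inverse_mult[OF G h(1)])
    have Q: "dirichlet E w f f = h \<bullet> f"
      using inner_laplacian[OF G(1), of f f] by (simp add: Lf inner_commute)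
    \<comment> \<open>With Q the energy of \<open>f\<close>, testing with a multiple a of
      \<open>f\<close> gives 2a\<epsilon>Q - a^2 MQ, which is largest at a = \<epsilon>/M with value
      \<epsilon>^2 Q/M.\<close>
    have sharp: "dirichlet E (reweight w \<pi> (\<rho> t)) ((\<epsilon> / M) *\<^sub>R f) ((\<epsilon> / M) *\<^sub>R f) \<le>
        \<epsilon>\<^sup>2 / M * (h \<bullet> f)" if t: "t \<in> {0..1}" for t
    proof -
      have "\<rho> t $ x / \<pi> $ x \<le> M" for x
      proof -
        have "\<rho> t $ x - \<pi> $ x \<le> K * \<bar>\<epsilon>\<bar>"
          using component_le_norm_cart[of "\<rho> t - \<pi>" x] near[OF t] by simp
        also have "\<dots> = C * \<bar>\<epsilon>\<bar> * p"
          using p(1) by (simp add: C_def)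
        also have "\<dots> \<le> C * \<bar>\<epsilon>\<bar> * \<pi> $ x"
          using \<open>0 < C\<close> by (intro mult_left_mono p) auto
        finally show ?thesis
          using positive_densities_pos[OF \<pi>, of x] by (simp add: M_def field_simps)
      qed
      then have "dirichlet E (reweight w \<pi> (\<rho> t)) f f \<le> M * dirichlet E w f f"
        by (intro dirichlet_mono reweight_le[OF G(1) \<pi> pos[OF t]])
      then have "(\<epsilon> / M)\<^sup>2 * dirichlet E (reweight w \<pi> (\<rho> t)) f f \<le> (\<epsilon> / M)\<^sup>2 * (M * (h \<bullet> f))"
        unfolding Q by (rule mult_left_mono) simp
      then show ?thesis
        using \<open>1 \<le> M\<close> by (simp add: power2_eq_square)
    qed
    have "\<rho> 1 = \<pi> + \<epsilon> *\<^sub>R h"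
      using adm by (simp add: admissible_def)
    then have "\<epsilon>\<^sup>2 / M * (h \<bullet> f) = 2 * (((\<epsilon> / M) *\<^sub>R f) \<bullet> (\<rho> 1 - \<pi>)) - \<epsilon>\<^sup>2 / M * (h \<bullet> f)"
      by (simp add: power2_eq_square inner_commute)
    then have "ennreal (\<epsilon>\<^sup>2 / M * (h \<bullet> f)) =
        ennreal (2 * (((\<epsilon> / M) *\<^sub>R f) \<bullet> (\<rho> 1 - \<pi>)) - \<epsilon>\<^sup>2 / M * (h \<bullet> f))"
      by (rule arg_cong)
    also have "\<dots> \<le> action E w \<pi> \<rho> \<psi>"
      by (rule action_ge_test_function[OF G(1) \<pi> adm _ sharp]) auto
    finally show ?thesis
      by (simp add: M_def f_def)
  qed
  ultimately show thesis
    by (intro that[of C]) (auto simp: transport_cost_def intro!: INF_greatest)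
qed

section \<open>Upper bound\<close>

lemma transport_cost_upper_bound:
  fixes E :: "'v::finite set set"
  assumes G: "weighted_graph E w" "connected_graph E" and \<pi>: "\<pi> \<in> positive_densities"
  obtains C where "C > 0"
    "\<And>h \<epsilon>. h \<in> zero_sum \<Longrightarrow> norm h \<le> 1 \<Longrightarrow> C * \<bar>\<epsilon>\<bar> < 1 \<Longrightarrow>
      \<pi> + \<epsilon> *\<^sub>R h \<in> positive_densities \<and>
      transport_cost E w \<pi> \<pi> (\<pi> + \<epsilon> *\<^sub>R h)
        \<le> ennreal (\<epsilon>\<^sup>2 / (1 - C * \<bar>\<epsilon>\<bar>) * (h \<bullet> (pseudo_inverse (laplacian E w) *v h)))"
proof -
  let ?X = "pseudo_inverse (laplacian E w)"
  obtain p where p: "0 < p" "\<And>x. p \<le> \<pi> $ x"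
    using positive_densities_lower_bound[OF \<pi>] by blast
  \<comment> \<open>Each entry of \<epsilon>h is at most |\<epsilon>| in absolute value, hence at
    most \<open>C * \<bar>\<epsilon>\<bar> * \<pi> $ x\<close>; so the segment stays above
    \<open>m\<close> times \<pi>.\<close>
  define C where "C = 1 / p"
  have "0 < C"
    using p by (simp add: C_def)
  moreover have "\<pi> + \<epsilon> *\<^sub>R h \<in> positive_densities \<and>
      transport_cost E w \<pi> \<pi> (\<pi> + \<epsilon> *\<^sub>R h) \<le> ennreal (\<epsilon>\<^sup>2 / (1 - C * \<bar>\<epsilon>\<bar>) * (h \<bullet> (?X *v h)))"
    if h: "h \<in> zero_sum" "norm h \<le> 1" and \<epsilon>: "C * \<bar>\<epsilon>\<bar> < 1" for h \<epsilon>
  proof -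
    define m where "m = 1 - C * \<bar>\<epsilon>\<bar>"
    define f where "f = ?X *v h"
    define \<rho> where "\<rho> t = \<pi> + t *\<^sub>R (\<epsilon> *\<^sub>R h)" for t :: real
    have "0 < m"
      using \<epsilon> by (simp add: m_def)
    have Lf: "laplacian E w *v f = h"
      unfolding f_def by (rule laplacian_pseudo_inverse_mult[OF G h(1)])
    have Q: "dirichlet E w f f = h \<bullet> f"
      using inner_laplacian[OF G(1), of f f] by (simp add: Lf inner_commute)
    have ge: "m * \<pi> $ x \<le> \<rho> t $ x" if t: "t \<in> {0..1}" for t x
    proof -
      have "\<bar>t * (\<epsilon> * h $ x)\<bar> \<le> 1 * (\<bar>\<epsilon>\<bar> * 1)"
        unfolding abs_mult using t h(2) component_le_norm_cart[of h x]
        by (intro mult_mono) auto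
      also have "\<dots> \<le> C * \<bar>\<epsilon>\<bar> * \<pi> $ x"
        using p(1) mult_left_mono[OF p(2)[of x], of "\<bar>\<epsilon>\<bar>"] by (simp add: C_def field_simps)
      finally show ?thesis
        by (simp add: \<rho>_def m_def left_diff_distrib)
    qed
    have pos: "\<rho> t \<in> positive_densities" if t: "t \<in> {0..1}" for t
    proof -
      have "0 < \<rho> t $ x" for x
        using ge[OF t, of x] mult_pos_pos[OF \<open>0 < m\<close> positive_densities_pos[OF \<pi>, of x]] by linarith
      moreover have "(\<Sum>x\<in>UNIV. \<rho> t $ x) = 1"
        using h(1) positive_densities_sum[OF \<pi>]
        by (simp add: \<rho>_def sum.distrib zero_sum_def flip: sum_distrib_left)
      ultimately show ?thesis
        by (simp add: positive_densities_def densities_def less_imp_le)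
    qed
    have G': "weighted_graph E (reweight w \<pi> (\<rho> t))" if "t \<in> {0..1}" for t
      by (intro weighted_graph_reweight G \<pi> pos that)
    have cont_w: "continuous_on {0..1} (\<lambda>t. reweight w \<pi> (\<rho> t) x y)" for x y
    proof -
      have "continuous_on {0..1} (\<lambda>t. \<rho> t $ x / \<pi> $ x)" for x
        unfolding \<rho>_def divide_inverse by (intro continuous_intros)
      then show ?thesis
        unfolding reweight_def using pos \<pi>
        by (intro continuous_on_mult continuous_on_const continuous_on_log_mean divide_pos_pos
            positive_densities_pos)
    qed
    have cont_L: "continuous_on {0..1} (\<lambda>t. (laplacian E (reweight w \<pi> (\<rho> t)) + averaging) $ i $ j)" for i j
      by (cases "i = j"; cases "{i, j} \<in> E")
        (auto simp: laplacian_def degree_matrix_def adjacency_matrix_def wdeg_def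
          intro!: continuous_intros cont_w)
    \<comment> \<open>Solving the regularized system with the constant velocity \<epsilon>h gives a
      potential continuous in time, hence Borel measurable.\<close>
    obtain \<psi> where \<psi>_cont: "continuous_on {0..1} \<psi>"
      and "\<And>t. t \<in> {0..1} \<Longrightarrow> (laplacian E (reweight w \<pi> (\<rho> t)) + averaging) *v \<psi> t = \<epsilon> *\<^sub>R h"
      by (rule continuous_on_linear_solve[OF cont_L invertible_laplacian_averaging[OF G' G(2)],
            where b = "\<epsilon> *\<^sub>R h"]) (assumption, rule that)
    moreover have "\<epsilon> *\<^sub>R h \<in> zero_sum"
      using h(1) by (simp add: zero_sum_def flip: sum_distrib_left)
    ultimately have L\<psi>: "\<epsilon> *\<^sub>R h = laplacian E (reweight w \<pi> (\<rho> t)) *v \<psi> t" if "t \<in> {0..1}" for t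
      using laplacian_solveI[OF G'[OF that]] that by metis
    have \<rho>_deriv: "(\<rho> has_vector_derivative \<epsilon> *\<^sub>R h) (at t within {0..1})" for t
      unfolding \<rho>_def by (auto intro!: derivative_eq_intros)
    have "admissible E w \<pi> \<pi> (\<pi> + \<epsilon> *\<^sub>R h) \<rho> \<psi>"
      unfolding admissible_def continuity_equation_iff
      using pos borel_measurable_continuous_on_restrict[OF \<psi>_cont]
      by (auto simp: \<rho>_def[of 0] \<rho>_def[of 1] intro!: exI[of _ "\<lambda>_. \<epsilon> *\<^sub>R h"] \<rho>_deriv L\<psi>)
    then have "transport_cost E w \<pi> \<pi> (\<pi> + \<epsilon> *\<^sub>R h) \<le> action E w \<pi> \<rho> \<psi>"
      unfolding transport_cost_def by (auto intro!: INF_lower2[of "(\<rho>, \<psi>)"])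
    also have "\<dots> \<le> (\<integral>\<^sup>+t\<in>{0..1::real}. ennreal (\<epsilon>\<^sup>2 / m * (h \<bullet> f)) \<partial>lborel)"
      unfolding action_eq_dirichlet
    proof (rule nn_integral_mono)
      fix t :: real
      let ?D = "dirichlet E (reweight w \<pi> (\<rho> t)) (\<psi> t) (\<psi> t)"
      have "?D \<le> \<epsilon>\<^sup>2 / m * (h \<bullet> f)" if t: "t \<in> {0..1}"
      proof -
        have "m \<le> \<rho> t $ x / \<pi> $ x" for x
          using ge[OF t, of x] positive_densities_pos[OF \<pi>, of x] by (simp add: field_simps)
        then have "m * w x y \<le> reweight w \<pi> (\<rho> t) x y" if "{x, y} \<in> E" for x y
          using reweight_ge[OF G(1) that \<open>0 < m\<close>] by blast
        then have "dirichlet E w (\<psi> t) (\<psi> t) \<le> 1 / m * ?D"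
          using \<open>0 < m\<close> by (intro dirichlet_mono) (simp add: field_simps)
        then have mono: "m * dirichlet E w (\<psi> t) (\<psi> t) \<le> ?D"
          using \<open>0 < m\<close> by (simp add: field_simps)
        have "?D = \<psi> t \<bullet> (\<epsilon> *\<^sub>R h)"
          unfolding L\<psi>[OF t] by (rule inner_laplacian[OF G'[OF t], symmetric])
        \<comment> \<open>As \<open>h\<close> is the original Laplacian of \<open>f\<close>, the
          reweighted energy becomes a pairing in the original form.\<close>
        also have "\<dots> = \<epsilon> * dirichlet E w (\<psi> t) f"
          using inner_laplacian[OF G(1), of "\<psi> t" f] by (simp add: Lf)
        finally have D: "?D = \<epsilon> * dirichlet E w (\<psi> t) f" .
        \<comment> \<open>Young's inequality with \<open>f\<close> scaled by \<epsilon>/m yields 2D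
          \<le> m D_w + \<epsilon>^2 Q/m, where D and D_w are the reweighted and original energies
          of the potential and Q is the original energy of \<open>f\<close>. Since m D_w \<le> D,
          one D cancels.\<close>
        have "m * (2 * dirichlet E w (\<psi> t) ((\<epsilon> / m) *\<^sub>R f)) \<le>
            m * (dirichlet E w (\<psi> t) (\<psi> t) + dirichlet E w ((\<epsilon> / m) *\<^sub>R f) ((\<epsilon> / m) *\<^sub>R f))"
          using \<open>0 < m\<close> by (intro mult_left_mono dirichlet_young G) auto
        then have "2 * ?D \<le> m * dirichlet E w (\<psi> t) (\<psi> t) + \<epsilon>\<^sup>2 / m * (h \<bullet> f)"
          using \<open>0 < m\<close> by (simp add: D Q distrib_left power2_eq_square)
        with mono show ?thesis
          by linarith
      qed
      then show "ennreal ?D * indicator {0..1} t \<le> ennreal (\<epsilon>\<^sup>2 / m * (h \<bullet> f)) * indicator {0..1} t"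
        by (auto simp: indicator_def intro!: ennreal_leI)
    qed
    also have "\<dots> = ennreal (\<epsilon>\<^sup>2 / m * (h \<bullet> f))"
      by (simp add: nn_integral_cmult_indicator)
    finally show ?thesis
      using pos[of 1] by (simp add: \<rho>_def m_def f_def)
  qed
  ultimately show thesis
    by (intro that[of C]) auto
qed

section \<open>From bounds on the cost to the squared distance and its expansion\<close>

theorem corollary1p3:
  fixes E :: "'v::finite set set"
    and w :: "'v \<Rightarrow> 'v \<Rightarrow> real"
    and \<pi> :: "real^'v"
  assumes "weighted_graph E w"
    and "connected_graph E"
    and "\<pi> \<in> positive_densities"
    and "stationary (srw_matrix E w) \<pi>"
  shows "(\<forall>x y. {x, y} \<in> E \<longrightarrow> reweight w \<pi> \<pi> x y = w x y)
    \<and> laplacian E (reweight w \<pi> \<pi>) = laplacian E w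
    \<and> (\<forall>h \<in> zero_sum. norm h \<le> 1 \<longrightarrow>
        (\<lambda>\<epsilon>::real. (transport_dist E w \<pi> \<pi> (\<pi> + \<epsilon> *\<^sub>R h))\<^sup>2
                  - \<bar>\<epsilon>\<bar>\<^sup>2 * (h \<bullet> (pseudo_inverse (laplacian E w) *v h)))
          \<in> o[at 0](\<lambda>\<epsilon>. \<bar>\<epsilon>\<bar>\<^sup>2))
    \<and> (\<exists>C>0. \<exists>C'>0. \<exists>\<epsilon>\<^sub>0>0. \<forall>h \<in> zero_sum. norm h \<le> 1 \<longrightarrow>
        (\<forall>\<epsilon>::real. \<bar>\<epsilon>\<bar> < \<epsilon>\<^sub>0 \<longrightarrow>
          \<pi> + \<epsilon> *\<^sub>R h \<in> positive_densities
          \<and> transport_cost E w \<pi> \<pi> (\<pi> + \<epsilon> *\<^sub>R h) < \<infinity>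
          \<and> 1 - C * \<bar>\<epsilon>\<bar> > 0
          \<and> \<epsilon>\<^sup>2 / (1 + C' * \<bar>\<epsilon>\<bar>) * (h \<bullet> (pseudo_inverse (laplacian E w) *v h))
              \<le> (transport_dist E w \<pi> \<pi> (\<pi> + \<epsilon> *\<^sub>R h))\<^sup>2
          \<and> (transport_dist E w \<pi> \<pi> (\<pi> + \<epsilon> *\<^sub>R h))\<^sup>2
              \<le> \<epsilon>\<^sup>2 / (1 - C * \<bar>\<epsilon>\<bar>) * (h \<bullet> (pseudo_inverse (laplacian E w) *v h))))"
proof -
  note G = assms(1,2) and \<pi> = assms(3)
  let ?Q = "\<lambda>h. h \<bullet> (pseudo_inverse (laplacian E w) *v h)"
  let ?cost = "\<lambda>h \<epsilon>. transport_cost E w \<pi> \<pi> (\<pi> + \<epsilon> *\<^sub>R h)"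
  let ?d = "\<lambda>h \<epsilon>. (transport_dist E w \<pi> \<pi> (\<pi> + \<epsilon> *\<^sub>R h))\<^sup>2"
  obtain C where C: "0 < C" and upper: "\<And>h \<epsilon>. h \<in> zero_sum \<Longrightarrow> norm h \<le> 1 \<Longrightarrow> C * \<bar>\<epsilon>\<bar> < 1 \<Longrightarrow>
      \<pi> + \<epsilon> *\<^sub>R h \<in> positive_densities \<and> ?cost h \<epsilon> \<le> ennreal (\<epsilon>\<^sup>2 / (1 - C * \<bar>\<epsilon>\<bar>) * ?Q h)"
    using transport_cost_upper_bound[OF G \<pi>] by metis
  obtain C' where C': "0 < C'" and lower: "\<And>h \<epsilon>. h \<in> zero_sum \<Longrightarrow> norm h \<le> 1 \<Longrightarrow>
      ennreal (\<epsilon>\<^sup>2 / (1 + C' * \<bar>\<epsilon>\<bar>) * ?Q h) \<le> ?cost h \<epsilon>"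
    using transport_cost_lower_bound[OF G \<pi>] by metis
  \<comment> \<open>The quadratic form is the energy of the pseudoinverse applied to
    \<open>h\<close>; its sign lets \<open>enn2real\<close> recover the real bounds from
    \<open>ennreal\<close>.\<close>
  have Q_nonneg: "0 \<le> ?Q h" if "h \<in> zero_sum" for h
    using dirichlet_nonneg[OF G(1)] laplacian_pseudo_inverse_mult[OF G that]
    by (metis inner_commute inner_laplacian[OF G(1)])
  have d_eq: "?d h \<epsilon> = enn2real (?cost h \<epsilon>)" for h \<epsilon>
    by (simp add: transport_dist_def)
  have bounds: "\<pi> + \<epsilon> *\<^sub>R h \<in> positive_densities \<and> ?cost h \<epsilon> < \<infinity> \<and> 1 - C * \<bar>\<epsilon>\<bar> > 0 \<and>
      \<epsilon>\<^sup>2 / (1 + C' * \<bar>\<epsilon>\<bar>) * ?Q h \<le> ?d h \<epsilon> \<and> ?d h \<epsilon> \<le> \<epsilon>\<^sup>2 / (1 - C * \<bar>\<epsilon>\<bar>) * ?Q h"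
    if h: "h \<in> zero_sum" "norm h \<le> 1" and "\<bar>\<epsilon>\<bar> < 1 / C" for h \<epsilon>
  proof -
    have \<epsilon>: "C * \<bar>\<epsilon>\<bar> < 1"
      using that C by (simp add: field_simps)
    have u: "?cost h \<epsilon> \<le> ennreal (\<epsilon>\<^sup>2 / (1 - C * \<bar>\<epsilon>\<bar>) * ?Q h)"
      using upper[OF h \<epsilon>] by simp
    \<comment> \<open>Finiteness matters because \<open>enn2real\<close> sends infinity to 0, so it
      is monotone only below infinity.\<close>
    then have fin: "?cost h \<epsilon> < \<infinity>"
      using le_less_trans[OF u ennreal_less_top] by simp
    have "enn2real (?cost h \<epsilon>) \<le> enn2real (ennreal (\<epsilon>\<^sup>2 / (1 - C * \<bar>\<epsilon>\<bar>) * ?Q h))"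
      by (rule enn2real_mono[OF u]) simp
    moreover have "enn2real (ennreal (\<epsilon>\<^sup>2 / (1 + C' * \<bar>\<epsilon>\<bar>) * ?Q h)) \<le> enn2real (?cost h \<epsilon>)"
      using fin by (intro enn2real_mono lower h) simp
    moreover have "0 \<le> \<epsilon>\<^sup>2 / (1 - C * \<bar>\<epsilon>\<bar>) * ?Q h" "0 \<le> \<epsilon>\<^sup>2 / (1 + C' * \<bar>\<epsilon>\<bar>) * ?Q h"
      using \<epsilon> C' Q_nonneg[OF h(1)] by simp_all
    ultimately show ?thesis
      using upper[OF h \<epsilon>] fin \<epsilon> by (simp add: d_eq)
  qed
  have "(\<lambda>\<epsilon>. ?d h \<epsilon> - \<bar>\<epsilon>\<bar>\<^sup>2 * ?Q h) \<in> o[at 0](\<lambda>\<epsilon>. \<bar>\<epsilon>\<bar>\<^sup>2)" if h: "h \<in> zero_sum" "norm h \<le> 1" for h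
  proof (rule smalloI_tendsto)
    have "\<forall>\<^sub>F \<epsilon> in at 0. \<bar>\<epsilon>\<bar> < 1 / C \<and> \<epsilon> \<noteq> 0"
      using C by (auto simp: eventually_at dist_real_def intro!: exI[of _ "1 / C"])
    \<comment> \<open>Division by \<epsilon>^2 in a punctured neighbourhood squeezes the remainder
      between two functions that tend to 0, as both denominators tend to 1.\<close>
    then have ev: "\<forall>\<^sub>F \<epsilon> in at 0.
        1 / (1 + C' * \<bar>\<epsilon>\<bar>) * ?Q h - ?Q h \<le> (?d h \<epsilon> - \<bar>\<epsilon>\<bar>\<^sup>2 * ?Q h) / \<bar>\<epsilon>\<bar>\<^sup>2 \<and>
        (?d h \<epsilon> - \<bar>\<epsilon>\<bar>\<^sup>2 * ?Q h) / \<bar>\<epsilon>\<bar>\<^sup>2 \<le> 1 / (1 - C * \<bar>\<epsilon>\<bar>) * ?Q h - ?Q h"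
    proof eventually_elim
      case (elim \<epsilon>)
      then have "\<epsilon>\<^sup>2 / (1 + C' * \<bar>\<epsilon>\<bar>) * ?Q h / \<epsilon>\<^sup>2 \<le> ?d h \<epsilon> / \<epsilon>\<^sup>2"
        "?d h \<epsilon> / \<epsilon>\<^sup>2 \<le> \<epsilon>\<^sup>2 / (1 - C * \<bar>\<epsilon>\<bar>) * ?Q h / \<epsilon>\<^sup>2"
        using bounds[OF h, of \<epsilon>] by (simp_all add: divide_right_mono del: times_divide_eq_left)
      then show ?case
        using elim by (simp add: diff_divide_distrib)
    qed
    have lim1: "((\<lambda>\<epsilon>. 1 / (1 + C' * \<bar>\<epsilon>\<bar>) * ?Q h - ?Q h) \<longlongrightarrow> 1 / (1 + C' * \<bar>0\<bar>) * ?Q h - ?Q h) (at 0)"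
      and lim2: "((\<lambda>\<epsilon>. 1 / (1 - C * \<bar>\<epsilon>\<bar>) * ?Q h - ?Q h) \<longlongrightarrow> 1 / (1 - C * \<bar>0\<bar>) * ?Q h - ?Q h) (at 0)"
      by (intro tendsto_intros; simp)+
    show "((\<lambda>\<epsilon>. (?d h \<epsilon> - \<bar>\<epsilon>\<bar>\<^sup>2 * ?Q h) / \<bar>\<epsilon>\<bar>\<^sup>2) \<longlongrightarrow> 0) (at 0)"
      using tendsto_sandwich[OF _ _ lim1[simplified] lim2[simplified], of "\<lambda>\<epsilon>. (?d h \<epsilon> - \<bar>\<epsilon>\<bar>\<^sup>2 * ?Q h) / \<bar>\<epsilon>\<bar>\<^sup>2"] ev
      by (simp add: eventually_conj_iff)
    show "\<forall>\<^sub>F \<epsilon> in at 0. \<bar>\<epsilon>\<bar>\<^sup>2 \<noteq> (0::real)"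
      by (auto simp: eventually_at intro: exI[of _ 1])
  qed
  moreover have "0 < 1 / C"
    using C by simp
  ultimately show ?thesis
    unfolding reweight_self[OF \<pi>] using C C' bounds by blast
qed

end
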